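(* Let $q$ be a prime power, let $r\ge 2$ be an even integer, and let $a\in\mathrm{GF}(q^2)^*$, $b\in\mathrm{GF}(q^2)\setminus\mathrm{GF}(q)$. Suppose that either $q$ is odd and $4a^{q+1}+(b^q-b)^2$ is a non-zero square in $\mathrm{GF}(q)$, or $q$ is even and $\mathrm{Tr}_q\big(a^{q+1}/(b^q+b)^2\big)=1$. Let $\mathcal{B}(a,b)$ be the set of points $(x_1,\dots,x_r)$ of $\mathrm{AG}(r,q^2)$ satisfying \[x_r^q-x_r+a^q(x_1^{2q}+\dots+x_{r-1}^{2q})-a(x_1^2+\dots+x_{r-1}^2)=(b^q-b)(x_1^{q+1}+\dots+x_{r-1}^{q+1}).\] Then $|\mathcal{B}(a,b)|=q^{2r-1}$ and $\mathcal{B}(a,b)$ is a three-character set with characters \[q^{2r-3}-q^{r-2},\quad q^{2r-3},\quad q^{2r-3}-q^{r-2}+q^{r-1},\] i.e. every hyperplane of $\mathrm{AG}(r,q^2)$ meets $\mathcal{B}(a,b)$ in one of these numbers of points. Moreover, $\mathcal{B}(a,b)$ is a minimal intersection set with respect to hyperplanes (a minimal $(q^{2r-3}-q^{r-2})$-intersection set).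
   Context: For $q=2^h$, $\mathrm{Tr}_q:\mathrm{GF}(q)\to\mathrm{GF}(2)$ is the absolute trace $x\mapsto x+x^2+x^{2^2}+\dots+x^{2^{h-1}}$. A set $S$ of points of $\mathrm{AG}(r,q^2)$ is a $t$-intersection set if every hyperplane contains at least $t>0$ points of $S$; a point $P\in S$ is essential if $S\setminus\{P\}$ is not a $t$-intersection set; $S$ is minimal if all its points are essential. A set is an $m$-character set if its intersection sizes with hyperplanes take only $m$ possible values (the characters). *)

theory Defs
  imports "HOL-Library.FuncSet" "HOL-Number_Theory.Prime_Powers"
begin

definition is_subfield :: "'a::field set \<Rightarrow> bool" where
  "is_subfield F \<longleftrightarrow> 0 \<in> F \<and> 1 \<in> F \<and>
     (\<forall>x\<in>F. \<forall>y\<in>F. x + y \<in> F \<and> x * y \<in> F) \<and>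
     (\<forall>x\<in>F. - x \<in> F \<and> inverse x \<in> F)"

text \<open>The absolute trace \<open>GF(2^h) \<rightarrow> GF(2)\<close>. It is written here on an ambient field,
  and is only meaningful on elements of the subfield of order \<open>2^h\<close>.\<close>

definition abs_trace :: "nat \<Rightarrow> 'a::field \<Rightarrow> 'a" where
  "abs_trace h x = (\<Sum>i<h. x ^ (2 ^ i))"

text \<open>Points of the \<open>r\<close>-dimensional affine space over the field \<open>'a\<close> are coordinate vectors
  \<open>(x 1, \<dots>, x r)\<close>; they are extensional functions, so that each point is counted once.\<close>

definition AG :: "nat \<Rightarrow> (nat \<Rightarrow> 'a::field) set" where
  "AG r = {1..r} \<rightarrow>\<^sub>E UNIV"

definition hyperplanes :: "nat \<Rightarrow> (nat \<Rightarrow> 'a::field) set set" where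
  "hyperplanes r =
     {{x \<in> AG r. (\<Sum>i=1..r. c i * x i) = d} | c d. \<exists>i\<in>{1..r}. c i \<noteq> 0}"

definition intersection_set :: "nat \<Rightarrow> nat \<Rightarrow> (nat \<Rightarrow> 'a::{field,finite}) set \<Rightarrow> bool" where
  "intersection_set r t S \<longleftrightarrow>
     S \<subseteq> AG r \<and> t > 0 \<and> (\<forall>H\<in>hyperplanes r. t \<le> card (H \<inter> S))"

definition essential_point ::
    "nat \<Rightarrow> nat \<Rightarrow> (nat \<Rightarrow> 'a::{field,finite}) set \<Rightarrow> (nat \<Rightarrow> 'a) \<Rightarrow> bool" where
  "essential_point r t S P \<longleftrightarrow> P \<in> S \<and> \<not> intersection_set r t (S - {P})"

definition minimal_intersection_set ::
    "nat \<Rightarrow> nat \<Rightarrow> (nat \<Rightarrow> 'a::{field,finite}) set \<Rightarrow> bool" where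
  "minimal_intersection_set r t S \<longleftrightarrow>
     intersection_set r t S \<and> (\<forall>P\<in>S. essential_point r t S P)"

text \<open>\<open>S\<close> is an \<open>m\<close>-character set whose set of characters is \<open>K\<close>: the intersection sizes
  with hyperplanes are exactly the \<open>m\<close> elements of \<open>K\<close>, each of them being attained.\<close>

definition character_set ::
    "nat \<Rightarrow> nat \<Rightarrow> nat set \<Rightarrow> (nat \<Rightarrow> 'a::{field,finite}) set \<Rightarrow> bool" where
  "character_set r m K S \<longleftrightarrow>
     S \<subseteq> AG r \<and> (\<lambda>H. card (H \<inter> S)) ` hyperplanes r = K \<and> card K = m"

definition B_set :: "nat \<Rightarrow> nat \<Rightarrow> 'a::field \<Rightarrow> 'a \<Rightarrow> (nat \<Rightarrow> 'a) set" where
  "B_set q r a b =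
     {x \<in> AG r.
        x r ^ q - x r + a ^ q * (\<Sum>i=1..r-1. x i ^ (2 * q)) - a * (\<Sum>i=1..r-1. x i ^ 2)
          = (b ^ q - b) * (\<Sum>i=1..r-1. x i ^ (q + 1))}"

end

(* Write K = GF(q^2) and n = r - 1. The equation of B(a,b) reads x_r^q - x_r = Q(x_1) + ... + Q(x_n)
   with Q(t) = (b^q - b) t^(q+1) - a^q t^(2q) + a t^2, a binary quadratic form over GF(q) with values
   in the line {e. e^q = -e}, which is also the image of z |-> z^q - z. The hypothesis on a and b
   says that a^q X^2 - (b^q - b) X - a has two distinct roots u, v of norm 1, i.e. that
   Q(t) = -a^q (t^q - u t) (t^q - v t) is hyperbolic; hence Q takes the value 0 exactly 2q - 1 times
   and each other value of the line q - 1 times. By convolution this gives the value distribution of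
   Q(x_1) + ... + Q(x_n). Substituting x_r = m.x + d and completing the
   square turns a non-vertical hyperplane section into a fibre of this sum, which is of the smaller
   size if the value is non-zero. Through each point of B(a,b) the slope m can be chosen so that
   this happens, whence minimality. *)

theory Submission
  imports Defs "HOL-Computational_Algebra.Polynomial" "HOL-Number_Theory.Residues"
begin

section \<open>Fibre counting\<close>

text \<open>The fibres over \<open>S\<close> partition \<open>A\<close>, so upper bounds whose total
  does not exceed the size of \<open>A\<close> must all be attained. This turns root counts and
  injections into exact fibre sizes.\<close>

lemma card_fibres_eq_if_bounded:
  fixes c :: "'b \<Rightarrow> nat"
  assumes "finite A" "finite S" "f ` A \<subseteq> S"
    and "\<And>s. s \<in> S \<Longrightarrow> card {x \<in> A. f x = s} \<le> c s"
    and "sum c S \<le> card A" "s \<in> S"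
  shows "card {x \<in> A. f x = s} = c s"
proof -
  have "card A = (\<Sum>s\<in>S. \<Sum>x\<in>{x \<in> A. f x = s}. 1)"
    using assms(1-3) by (subst sum.group) auto
  then have "card A = (\<Sum>s\<in>S. card {x \<in> A. f x = s})"
    by simp
  moreover have "(\<Sum>s\<in>S. card {x \<in> A. f x = s}) \<le> sum c S"
    using assms(4) by (rule sum_mono)
  ultimately have "(\<Sum>s\<in>S. card {x \<in> A. f x = s}) = sum c S"
    using assms(5) by simp
  then show ?thesis
    using assms by (intro sum_mono_inv[of "\<lambda>s. card {x \<in> A. f x = s}" S c]) auto
qed

lemma card_Collect_eq_conj: "card {z. z = l \<and> Q z} = (if Q l then 1 else 0)"
proof -
  have "{z. z = l \<and> Q z} = (if Q l then {l} else {})"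
    by auto
  then show ?thesis
    by simp
qed

lemma sum_if_const:
  fixes c :: nat
  assumes "finite A"
  shows "(\<Sum>x\<in>A. if P x then c else 0) = c * card {x \<in> A. P x}"
  using assms by (simp flip: sum.inter_filter)

lemma finite_AG [simp]: "finite (AG n :: (nat \<Rightarrow> 'a::{field,finite}) set)"
  by (simp add: AG_def finite_PiE)

lemma card_AG: "card (AG n :: (nat \<Rightarrow> 'a::{field,finite}) set) = card (UNIV :: 'a set) ^ n"
  by (simp add: AG_def card_PiE)

text \<open>Slicing along the last coordinate: every point of the larger space extends a unique
  \<open>y\<close> in \<open>AG n\<close> by a value \<open>z\<close>. The counts by dimension below
  rest on this.\<close>

lemma card_AG_Suc_Collect:
  fixes P :: "(nat \<Rightarrow> 'a::{field,finite}) \<Rightarrow> bool"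
  shows "card {x \<in> AG (Suc n). P x} = (\<Sum>y\<in>AG n. card {z. P (y(Suc n := z))})"
proof -
  let ?S = "SIGMA y:AG n. {z. P (y(Suc n := z))}"
  have AG_Suc: "AG (Suc n) = (\<lambda>(z, y). y(Suc n := z)) ` (UNIV \<times> (AG n :: (nat \<Rightarrow> 'a) set))"
    by (simp add: AG_def atLeastAtMostSuc_conv PiE_insert_eq)
  have "bij_betw (\<lambda>(y, z). y(Suc n := z)) ?S {x \<in> AG (Suc n). P x}"
    unfolding bij_betw_def
  proof
    show "inj_on (\<lambda>(y, z). y(Suc n := z)) ?S"
    proof (rule inj_onI, clarsimp)
      fix y z y' z'
      assume yy: "y \<in> AG n" "y' \<in> AG n" and eq: "y(Suc n := z) = y'(Suc n := z')"
      have "y i = y' i" for i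
      proof (cases "i = Suc n")
        \<comment> \<open>Points of \<open>AG n\<close> are extensional, so both take the same
          default value outside \<open>{1..n}\<close>.\<close>
        case True
        then show ?thesis
          using yy by (simp add: AG_def PiE_iff extensional_def)
      next
        case False
        then show ?thesis
          using fun_cong[OF eq, of i] by simp
      qed
      then show "y = y' \<and> z = z'"
        using fun_cong[OF eq, of "Suc n"] by auto
    qed
    show "(\<lambda>(y, z). y(Suc n := z)) ` ?S = {x \<in> AG (Suc n). P x}"
      unfolding AG_Suc by force
  qed
  then have "card {x \<in> AG (Suc n). P x} = card ?S"
    by (simp add: bij_betw_same_card)
  then show ?thesis
    by simp
qed

text \<open>If the last coefficient is zero, the last coordinate is free and induction applies;
  otherwise it is determined by the others. The product form avoids the exponent
  \<open>n - 1\<close>.\<close>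

lemma card_affine_hyperplane:
  fixes c :: "nat \<Rightarrow> 'a::{field,finite}"
  assumes "\<exists>i\<in>{1..n}. c i \<noteq> 0"
  shows "card (UNIV :: 'a set) * card {y \<in> AG n. (\<Sum>i=1..n. c i * y i) = d}
    = card (UNIV :: 'a set) ^ n"
  using assms
proof (induction n)
  case (Suc n)
  have rec: "card {y \<in> AG (Suc n). (\<Sum>i=1..Suc n. c i * y i) = d}
      = (\<Sum>y\<in>AG n. card {z. (\<Sum>i=1..n. c i * y i) + c (Suc n) * z = d})"
    by (subst card_AG_Suc_Collect) simp
  show ?case
  proof (cases "c (Suc n) = 0")
    case True
    then have "\<exists>i\<in>{1..n}. c i \<noteq> 0"
      using Suc.prems by (metis atLeastAtMost_iff le_Suc_eq)
    note IH = Suc.IH[OF this]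
    have "card {z. (\<Sum>i=1..n. c i * y i) + c (Suc n) * z = d}
      = (if (\<Sum>i=1..n. c i * y i) = d then card (UNIV :: 'a set) else 0)" for y
      by (simp add: True)
    then have "card {y \<in> AG (Suc n). (\<Sum>i=1..Suc n. c i * y i) = d}
      = card (UNIV :: 'a set) * card {y \<in> AG n. (\<Sum>i=1..n. c i * y i) = d}"
      unfolding rec by (simp only: sum_if_const[OF finite_AG])
    then show ?thesis
      using IH by simp
  next
    case False
    have "{z. (\<Sum>i=1..n. c i * y i) + c (Suc n) * z = d}
      = {(d - (\<Sum>i=1..n. c i * y i)) / c (Suc n)}" for y
      using False by (auto simp: field_simps)
    then show ?thesis
      unfolding rec by (simp add: card_AG)
  qed
qed simp

section \<open>The conjugation of a quadratic extension of finite fields\<close>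

text \<open>Multiplication by a nonzero \<open>x\<close> permutes the nonzero elements of
  \<open>F\<close>; comparing their products gives Fermat's identity.\<close>

lemma subfield_power_card:
  fixes F :: "'a::{field,finite} set"
  assumes "is_subfield F" "x \<in> F"
  shows "x ^ card F = x"
proof (cases "x = 0")
  case True
  then show ?thesis
    using assms by (auto simp: card_gt_0_iff)
next
  case False
  have closed: "y * z \<in> F" "inverse y \<in> F" if "y \<in> F" "z \<in> F" for y z
    using assms(1) that by (auto simp: is_subfield_def)
  have "0 \<in> F"
    using assms(1) by (simp add: is_subfield_def)
  have "(\<Prod>y\<in>F-{0}. x * y) = \<Prod>(F-{0})"
    by (rule prod.reindex_bij_witness[of _ "\<lambda>y. inverse x * y" "\<lambda>y. x * y"])
      (use False assms(2) closed in auto)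
  then have "x ^ card (F-{0}) * \<Prod>(F-{0}) = \<Prod>(F-{0})"
    by (simp add: prod.distrib)
  moreover have "\<Prod>(F-{0}) \<noteq> 0"
    by simp
  ultimately have "x ^ card (F-{0}) = 1"
    by simp
  moreover have "card F = Suc (card (F-{0}))"
    using \<open>0 \<in> F\<close> by (simp only: card.remove[OF finite])
  ultimately show ?thesis
    by simp
qed

text \<open>Keeping \<open>frob\<close> as a symbol of its own lets the simplifier treat it as a
  field automorphism rather than as a power.\<close>

locale conjugation =
  fixes q :: nat and frob :: "'a::{field,finite} \<Rightarrow> 'a"
  assumes primepow_q: "primepow q"
    and card_UNIV: "card (UNIV :: 'a set) = q ^ 2"
    and frob_def: "frob x = x ^ q"
begin

lemma q_gt_1: "q > 1"
  using primepow_gt_Suc_0[OF primepow_q] by simp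

text \<open>The characteristic is a prime dividing the order of the field, a power of the prime
  below \<open>q\<close>. The additivity of \<open>frob\<close> depends on this.\<close>

lemma q_eq_CHAR_power: "prime CHAR('a) \<and> (\<exists>k>0. q = CHAR('a) ^ k)"
proof -
  have "CHAR('a) > 0"
    by (rule finite_imp_CHAR_pos) simp
  then have pr: "prime CHAR('a)"
    by (rule prime_CHAR_semidom)
  obtain p k where pk: "prime p" "k > 0" "q = p ^ k"
    using primepow_q by (auto simp: primepow_def)
  have "CHAR('a) dvd p ^ (k * 2)"
    using CHAR_dvd_CARD[where 'a = 'a] by (simp add: card_UNIV pk(3) power_mult)
  then have "CHAR('a) = p"
    using pr pk(1) prime_dvd_power primes_dvd_imp_eq by blast
  then show ?thesis
    using pr pk by auto
qed

lemma even_q_iff: "even q \<longleftrightarrow> (2 :: 'a) = 0"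
proof -
  obtain k where k: "prime CHAR('a)" "k > 0" "q = CHAR('a) ^ k"
    using q_eq_CHAR_power by blast
  have "even q \<longleftrightarrow> CHAR('a) = 2"
    using k by (metis dvd_power prime_dvd_power primes_dvd_imp_eq two_is_prime_nat)
  also have "\<dots> \<longleftrightarrow> (2 :: 'a) = 0"
    using k(1) of_nat_eq_0_iff_char_dvd[of 2, where 'a = 'a]
    by (metis of_nat_numeral primes_dvd_imp_eq two_is_prime_nat dvd_refl)
  finally show ?thesis .
qed

lemma uminus_eq_if_even:
  assumes "even q"
  shows "- x = (x :: 'a)"
  using assms even_q_iff by (metis add_eq_0_iff mult_2 mult_zero_left)

lemma frob_add [simp]: "frob (x + y) = frob x + frob y"
  using q_eq_CHAR_power freshmans_dream'[of q _ x y] by (auto simp: frob_def)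

lemma frob_mult [simp]: "frob (x * y) = frob x * frob y"
  by (simp add: frob_def power_mult_distrib)

lemma frob_power [simp]: "frob (x ^ k) = frob x ^ k"
  by (simp add: frob_def flip: power_mult) (simp add: mult.commute)

lemma frob_0 [simp]: "frob 0 = 0" and frob_1 [simp]: "frob 1 = 1"
  using q_gt_1 by (simp_all add: frob_def)

lemma frob_minus [simp]: "frob (- x) = - frob x"
  using frob_add[of x "- x"] by (simp add: eq_neg_iff_add_eq_0 add.commute del: frob_add)

lemma frob_diff [simp]: "frob (x - y) = frob x - frob y"
  using frob_add[of x "- y"] by (simp del: frob_add)

lemma frob_divide [simp]: "frob (x / y) = frob x / frob y"
  by (simp add: frob_def power_divide)

lemma frob_sum: "frob (sum f A) = (\<Sum>x\<in>A. frob (f x))"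
  by (induction A rule: infinite_finite_induct) auto

lemma frob_numeral [simp]: "frob (numeral n) = numeral n"
  by (induction n) (simp_all only: numeral.simps frob_add frob_1)

lemma frob_frob [simp]: "frob (frob x) = x"
proof -
  have "is_subfield (UNIV :: 'a set)"
    by (simp add: is_subfield_def)
  from subfield_power_card[OF this, of x] show ?thesis
    by (simp add: frob_def card_UNIV power2_eq_square power_mult)
qed

lemma frob_eq_0_iff [simp]: "frob x = 0 \<longleftrightarrow> x = 0"
  using q_gt_1 by (simp add: frob_def)

text \<open>The eigenspaces of conjugation over GF(q): \<open>eigen 1\<close> is GF(q) itself, and
  \<open>eigen (- 1)\<close> is the line containing all values of the quadratic form.\<close>

definition eigen :: "'a \<Rightarrow> 'a set" where
  "eigen u = {x. frob x = u * x}"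

text \<open>The elements are the roots of X^q - u X, a polynomial of degree q.\<close>

lemma card_eigen_le: "card (eigen u) \<le> q"
proof -
  let ?p = "Polynomial.monom 1 q + [:0, - u:]"
  have "degree ?p = q"
    using q_gt_1 by (subst degree_add_eq_left) (simp_all add: degree_monom_eq)
  moreover from this have "?p \<noteq> 0"
    using q_gt_1 by auto
  moreover have "{x. poly ?p x = 0} = eigen u"
    by (auto simp: eigen_def poly_monom frob_def mult.commute)
  ultimately show ?thesis
    using card_poly_roots_bound[of ?p] by simp
qed

lemma frob_diff_mem_eigen:
  assumes "u * frob u = 1"
  shows "frob t - u * t \<in> eigen (- frob u)"
proof -
  have "frob u * (u * t) = t"
    using assms by (metis mult.assoc mult.commute mult_1)
  then show ?thesis
    by (simp add: eigen_def algebra_simps)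
qed

text \<open>Additive Hilbert 90, twisted by an element \<open>u\<close> of norm 1.\<close>

lemma card_frob_fibre:
  assumes u: "u * frob u = 1" and s: "s \<in> eigen (- frob u)"
  shows "card {t. frob t - u * t = s} = q"
proof -
  have le: "card {t \<in> UNIV. frob t - u * t = s'} \<le> q" for s'
  proof (cases "\<exists>t\<^sub>0. frob t\<^sub>0 - u * t\<^sub>0 = s'")
    case True
    then obtain t\<^sub>0 where t0: "frob t\<^sub>0 - u * t\<^sub>0 = s'"
      by blast
    \<comment> \<open>A nonempty fibre is a translate of the kernel \<open>eigen u\<close>.\<close>
    have "card {t \<in> UNIV. frob t - u * t = s'} \<le> card (eigen u)"
    proof (rule card_inj_on_le[of "\<lambda>t. t - t\<^sub>0"])
      show "(\<lambda>t. t - t\<^sub>0) ` {t \<in> UNIV. frob t - u * t = s'} \<subseteq> eigen u"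
        using t0 by (auto simp: eigen_def algebra_simps)
    qed (auto simp: inj_on_def)
    then show ?thesis
      using card_eigen_le[of u] by simp
  qed simp
  have "card {t \<in> UNIV. frob t - u * t = s} = q"
  \<comment> \<open>The q^2 elements \<open>t\<close> have at most q possible images with at most q
    preimages each, so both bounds are sharp.\<close>
  proof (rule card_fibres_eq_if_bounded[where S = "eigen (- frob u)" and c = "\<lambda>_. q"])
    show "range (\<lambda>t. frob t - u * t) \<subseteq> eigen (- frob u)"
      using frob_diff_mem_eigen[OF u] by blast
    show "(\<Sum>s\<in>eigen (- frob u). q) \<le> card (UNIV :: 'a set)"
      using card_eigen_le[of "- frob u"] by (simp add: card_UNIV power2_eq_square)
  qed (use s le in auto)
  then show ?thesis
    by simp
qed

lemma card_eigen:
  assumes "u * frob u = 1"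
  shows "card (eigen u) = q"
  using card_frob_fibre[OF assms, of 0] by (simp add: eigen_def)

text \<open>Elements of \<open>F\<close> are fixed by conjugation, and both sets have q
  elements.\<close>

lemma subfield_eq_eigen_1:
  assumes "is_subfield F" "card F = q"
  shows "F = eigen 1"
proof (rule card_subset_eq)
  show "F \<subseteq> eigen 1"
    using subfield_power_card[OF assms(1)] assms(2) by (auto simp: eigen_def frob_def)
qed (simp_all add: assms card_eigen)

lemma exists_frob_neq: "\<exists>d. frob d \<noteq> d"
proof (rule ccontr)
  assume "\<nexists>d. frob d \<noteq> d"
  then have "eigen 1 = UNIV"
    by (auto simp: eigen_def)
  then have "q ^ 2 = q"
    using card_eigen[of 1] card_UNIV by simp
  then show False
    using q_gt_1 by (simp add: power2_eq_square)
qed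

text \<open>A root \<open>w\<close> exists in GF(q^2) by counting; the trace of \<open>c\<close>
  telescopes to \<open>frob w - w\<close>, so trace 1 forces \<open>w\<close> outside GF(q), with
  \<open>w + 1\<close> as its conjugate.\<close>

lemma char_2_artin_schreier:
  assumes "even q" and q: "q = 2 ^ h" and c: "frob c = c" and tr: "abs_trace h c = 1"
  obtains w where "w ^ 2 + w = c" "frob w = w + 1"
proof -
  have two: "(2 :: 'a) = 0"
    using assms(1) even_q_iff by simp
  have CHAR: "CHAR('a) = 2"
    using q_eq_CHAR_power two of_nat_eq_0_iff_char_dvd[of 2, where 'a = 'a]
    by (metis of_nat_numeral primes_dvd_imp_eq two_is_prime_nat)
  have minus: "- x = x" for x :: 'a
    using assms(1) by (rule uminus_eq_if_even)
  \<comment> \<open>GF(q) and one further coset: exactly the \<open>w\<close> with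
    \<open>w ^ 2 + w\<close> in GF(q). On these 2q elements the map has fibres of size at most 2, so
    it hits all q elements of GF(q).\<close>
  let ?W = "{w. frob w - 1 * w = 0} \<union> {w. frob w - 1 * w = 1}"
  have cardW: "card ?W = 2 * q"
    using card_frob_fibre[of 1 0] card_frob_fibre[of 1 1]
    by (subst card_Un_disjoint) (auto simp: eigen_def minus)
  have "card {w \<in> ?W. w ^ 2 + w = c} = 2"
  proof (rule card_fibres_eq_if_bounded[where S = "eigen 1" and c = "\<lambda>_. 2"])
    show "(\<lambda>w. w ^ 2 + w) ` ?W \<subseteq> eigen 1"
    proof clarsimp
      fix w assume "frob w = w \<or> frob w - w = 1"
      then have "frob w = w \<or> frob w = w + 1"
        by (auto simp: algebra_simps)
      moreover have "(w + 1)\<^sup>2 + (w + 1) = w\<^sup>2 + w + (2 * w + 2)"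
        by (simp add: power2_eq_square algebra_simps)
      ultimately show "w\<^sup>2 + w \<in> eigen 1"
        using two by (auto simp: eigen_def)
    qed
    show "card {w \<in> ?W. w ^ 2 + w = s} \<le> 2" for s
    proof (cases "\<exists>w\<^sub>0. w\<^sub>0 ^ 2 + w\<^sub>0 = s")
      case True
      then obtain w\<^sub>0 where w0: "w\<^sub>0 ^ 2 + w\<^sub>0 = s"
        by blast
      have "w = w\<^sub>0 \<or> w = w\<^sub>0 + 1" if "w ^ 2 + w = s" for w
      proof -
        have "(w - w\<^sub>0) * (w - w\<^sub>0 - 1) = (w ^ 2 + w) - (w\<^sub>0 ^ 2 + w\<^sub>0) - 2 * w - 2 * w * w\<^sub>0
            + 2 * w\<^sub>0 ^ 2 + 2 * w\<^sub>0"
          by (simp add: power2_eq_square algebra_simps)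
        also have "\<dots> = 0"
          using that w0 two by simp
        finally have "w - w\<^sub>0 = 0 \<or> w - w\<^sub>0 - 1 = 0"
          by simp
        then show ?thesis
          by (auto simp: algebra_simps)
      qed
      then have "{w \<in> ?W. w ^ 2 + w = s} \<subseteq> {w\<^sub>0, w\<^sub>0 + 1}"
        by blast
      then have "card {w \<in> ?W. w ^ 2 + w = s} \<le> card {w\<^sub>0, w\<^sub>0 + 1}"
        by (intro card_mono) auto
      then show ?thesis
        by (simp add: card_insert_if)
    qed simp
    show "(\<Sum>s\<in>eigen 1. 2) \<le> card ?W"
      by (simp only: cardW) (simp add: card_eigen)
  qed (use c in \<open>auto simp: eigen_def\<close>)
  then obtain w where w: "w ^ 2 + w = c"
    by (metis (mono_tags, lifting) Collect_empty_eq card.empty zero_neq_numeral)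
  \<comment> \<open>Raising to the power 2^i is additive, and the sign is immaterial in
    characteristic 2; hence the trace telescopes.\<close>
  have "c ^ (2 ^ i) = w ^ (2 ^ Suc i) - w ^ (2 ^ i)" for i
    using freshmans_dream'[of "2 ^ i" i "w ^ 2" w] w minus[of "w ^ (2 ^ i)"]
    by (simp add: CHAR flip: power_mult)
  then have "abs_trace h c = (\<Sum>i<h. w ^ (2 ^ Suc i) - w ^ (2 ^ i))"
    unfolding abs_trace_def by (intro sum.cong refl)
  also have "\<dots> = frob w - w"
    by (subst sum_lessThan_telescope) (simp add: frob_def q)
  finally show thesis
    using that w tr by (simp add: algebra_simps)
qed

end

section \<open>Hyperbolic binary forms\<close>

text \<open>The two linear factors \<open>t\<^sup>q - u t\<close> and \<open>t\<^sup>q - v t\<close> each take values in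
  a line over \<open>GF(q)\<close>, so that \<open>form\<close> is, up to scalars, the hyperbolic form \<open>x y\<close> on \<open>GF(q)\<^sup>2\<close>.\<close>

locale hyperbolic_form = conjugation +
  fixes a \<beta> u v :: 'a
  assumes norm_u: "u * frob u = 1" and norm_v: "v * frob v = 1" and u_neq_v: "u \<noteq> v"
    and a_nonzero: "a \<noteq> 0"
    and beta: "\<beta> = frob a * (u + v)" and a_eq: "a = - (frob a * u * v)"
begin

text \<open>In the application \<open>\<beta>\<close> is b^q - b.\<close>

definition form :: "'a \<Rightarrow> 'a" where
  "form t = \<beta> * (t * frob t) - frob a * frob t ^ 2 + a * t ^ 2"

text \<open>Norm 1 makes conjugates inverses, so u + v is conjugate to (u + v) / (u v), and
  \<open>a_eq\<close> absorbs the denominator. As a consequence the values of \<open>form\<close>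
  lie in \<open>eigen (- 1)\<close>.\<close>

lemma frob_beta: "frob \<beta> = - \<beta>"
proof -
  have "frob \<beta> = a * (frob u + frob v)"
    by (simp add: beta)
  also have "\<dots> = - (frob a * (v * (u * frob u) + u * (v * frob v)))"
    by (subst a_eq) (simp add: algebra_simps)
  also have "\<dots> = - \<beta>"
    by (simp add: norm_u norm_v beta algebra_simps)
  finally show ?thesis .
qed

lemma form_factor: "form t = - frob a * ((frob t - u * t) * (frob t - v * t))"
proof -
  have "form t = frob a * (u + v) * (t * frob t) - frob a * frob t ^ 2 + - (frob a * u * v) * t ^ 2"
    unfolding form_def using beta a_eq by metis
  then show ?thesis
    by (simp add: algebra_simps power2_eq_square)
qed

lemma form_0 [simp]: "form 0 = 0"
  using q_gt_1 by (simp add: form_def)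

lemma frob_form: "frob (form t) = - form t"
  by (simp add: form_def frob_beta algebra_simps)

lemma card_form_eq_0: "card {t. form t = 0} = 2 * q - 1"
proof -
  have "{t. form t = 0} = eigen u \<union> eigen v"
    using a_nonzero by (auto simp: form_factor eigen_def)
  moreover have "eigen u \<inter> eigen v = {0}"
    using u_neq_v by (auto simp: eigen_def)
  ultimately show ?thesis
    using card_Un_Int[of "eigen u" "eigen v"] by (simp add: card_eigen norm_u norm_v)
qed

text \<open>For a nonzero value the first linear factor is nonzero and determines the second; their
  difference is (v - u) t, which recovers t. So t is determined by a nonzero point of a
  line.\<close>

lemma card_form_eq_le:
  assumes "e \<noteq> 0"
  shows "card {t. form t = e} \<le> q - 1"
proof -
  have norm: "- frob u * frob (- frob u) = 1"
    using norm_u by (simp add: mult.commute)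
  have "card {t. form t = e} \<le> card (eigen (- frob u) - {0})"
  proof (rule card_inj_on_le[of "\<lambda>t. frob t - u * t"])
    show "inj_on (\<lambda>t. frob t - u * t) {t. form t = e}"
    proof (rule inj_onI)
      fix t t' assume t: "t \<in> {t. form t = e}" "t' \<in> {t. form t = e}"
        and eq: "frob t - u * t = frob t' - u * t'"
      have "form t = form t'"
        using t by simp
      then have "- frob a * ((frob t - u * t) * (frob t - v * t))
          = - frob a * ((frob t - u * t) * (frob t' - v * t'))"
        by (simp only: form_factor eq)
      moreover have "frob t - u * t \<noteq> 0"
        using t assms by (auto simp: form_factor)
      ultimately have "frob t - v * t = frob t' - v * t'"
        by (metis a_nonzero frob_eq_0_iff mult_left_cancel neg_equal_0_iff_equal)
      moreover have "(v - u) * x = (frob x - u * x) - (frob x - v * x)" for x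
        by (simp add: algebra_simps)
      ultimately have "(v - u) * t = (v - u) * t'"
        by (simp only: eq)
      then show "t = t'"
        using u_neq_v by simp
    qed
    show "(\<lambda>t. frob t - u * t) ` {t. form t = e} \<subseteq> eigen (- frob u) - {0}"
      using assms frob_diff_mem_eigen[OF norm_u] by (auto simp: form_factor)
  qed simp
  also have "\<dots> = q - 1"
    using card_eigen[OF norm] by (simp add: eigen_def)
  finally show ?thesis .
qed

text \<open>The upper bounds add up to q (q - 1) + q = q^2, the number of all \<open>t\<close>, so
  they are attained.\<close>

lemma card_form_eq:
  assumes "frob e = - e"
  shows "card {t. form t = e} = (q - 1) + (if e = 0 then q else 0)"
proof -
  have "card {t \<in> UNIV. form t = e} = (q - 1) + (if e = 0 then q else 0)"
  proof (rule card_fibres_eq_if_bounded[where S = "eigen (- 1)"])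
    show "range form \<subseteq> eigen (- 1)"
      by (auto simp: eigen_def frob_form)
    show "card {t \<in> UNIV. form t = s} \<le> (q - 1) + (if s = 0 then q else 0)" for s
      using card_form_eq_0 card_form_eq_le[of s] by auto
    have "0 \<in> eigen (- 1)"
      by (simp add: eigen_def)
    then have "(\<Sum>s\<in>eigen (- 1). (q - 1) + (if s = 0 then q else 0)) = q * (q - 1) + q"
      by (simp add: sum.distrib card_eigen)
    also have "\<dots> = card (UNIV :: 'a set)"
      using q_gt_1 by (cases q) (simp_all add: card_UNIV power2_eq_square)
    finally show "(\<Sum>s\<in>eigen (- 1). (q - 1) + (if s = 0 then q else 0)) \<le> card (UNIV :: 'a set)"
      by simp
  qed (use assms in \<open>auto simp: eigen_def\<close>)
  then show ?thesis
    by simp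
qed

lemma exists_form_neq_0: "\<exists>t. form t \<noteq> 0"
proof (rule ccontr)
  assume "\<nexists>t. form t \<noteq> 0"
  then have "{t. form t = 0} = UNIV"
    by auto
  then have "2 * q - 1 = q ^ 2"
    using card_form_eq_0 card_UNIV by simp
  then have "(q - 1) * (q - 1) = 0"
    using q_gt_1 by (cases q) (simp_all add: power2_eq_square)
  then show False
    using q_gt_1 by simp
qed

text \<open>The count is q^(2n-1) - q^(n-1), plus q^n if e = 0; multiplying by q and moving the
  negative term keeps this in the naturals and valid for n = 0. In the induction each
  \<open>y\<close> has q - 1 extensions, and q more exactly when its sum is already
  \<open>e\<close>, so the same \<open>e\<close> serves throughout.\<close>

lemma card_sum_form_translate_eq:
  assumes "frob e = - e"
  shows "q * card {y \<in> AG n. (\<Sum>i=1..n. form (y i + w i)) = e} + q ^ n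
    = q ^ (2 * n) + (if e = 0 then q ^ (n + 1) else 0)"
proof (induction n)
  case 0
  show ?case
    by (auto simp: AG_def)
next
  case (Suc n)
  let ?S = "\<lambda>y. \<Sum>i=1..n. form (y i + w i)"
  have fibre: "card {z. ?S y + form (z + w (Suc n)) = e} = (q - 1) + (if ?S y = e then q else 0)"
    for y
  proof -
    have "frob (e - ?S y) = - (e - ?S y)"
      by (simp add: assms frob_sum frob_form sum_negf)
    from card_form_eq[OF this]
    have "card {t. form t = e - ?S y} = (q - 1) + (if ?S y = e then q else 0)"
      by auto
    moreover have "bij_betw (\<lambda>z. z + w (Suc n)) {z. ?S y + form (z + w (Suc n)) = e}
        {t. form t = e - ?S y}"
      by (rule bij_betw_byWitness[of _ "\<lambda>t. t - w (Suc n)"]) (auto simp: algebra_simps)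
    ultimately show ?thesis
      by (simp add: bij_betw_same_card)
  qed
  have "card {y \<in> AG (Suc n). (\<Sum>i=1..Suc n. form (y i + w i)) = e}
      = (\<Sum>y\<in>AG n. card {z. ?S y + form (z + w (Suc n)) = e})"
    by (subst card_AG_Suc_Collect) simp
  also have "\<dots> = (q - 1) * q ^ (2 * n) + q * card {y \<in> AG n. ?S y = e}"
    by (simp only: fibre sum.distrib sum_if_const[OF finite_AG])
      (simp add: card_AG card_UNIV power_mult)
  finally have rec: "card {y \<in> AG (Suc n). (\<Sum>i=1..Suc n. form (y i + w i)) = e}
      = (q - 1) * q ^ (2 * n) + q * card {y \<in> AG n. ?S y = e}" .
  obtain k where k: "q = Suc k"
    using q_gt_1 by (cases q) auto
  have "q * ((q - 1) * q ^ (2 * n) + q * card {y \<in> AG n. ?S y = e}) + q ^ Suc n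
      = (q - 1) * q ^ (2 * n + 1) + q * (q * card {y \<in> AG n. ?S y = e} + q ^ n)"
    by (simp add: algebra_simps)
  also have "\<dots> = (q - 1) * q ^ (2 * n + 1) + q * (q ^ (2 * n) + (if e = 0 then q ^ (n + 1) else 0))"
    by (simp only: Suc.IH)
  also have "\<dots> = q ^ (2 * Suc n) + (if e = 0 then q ^ (Suc n + 1) else 0)"
    by (simp add: k algebra_simps)
  finally show ?case
    unfolding rec .
qed

section \<open>Polarisation and nondegeneracy of the form\<close>

text \<open>The polar bilinear form of \<open>form\<close> at t and w is \<open>polar w * t\<close>
  minus its conjugate.\<close>

definition polar :: "'a \<Rightarrow> 'a" where
  "polar w = \<beta> * frob w + 2 * a * w"

lemma form_add:
  "form (t + w) = form t + form w + polar w * t - frob (polar w) * frob t"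
  by (simp add: form_def polar_def frob_beta algebra_simps power2_eq_square)

text \<open>The equation and its conjugate form a linear system in \<open>w\<close> and
  \<open>frob w\<close> whose determinant is, up to sign, the discriminant (u - v)^2. This works in
  every characteristic.\<close>

lemma polar_eq_0_imp:
  assumes "polar w = 0"
  shows "w = 0"
proof -
  have "polar w = frob a * ((u + v) * frob w - 2 * u * v * w)"
  proof -
    have "polar w = frob a * (u + v) * frob w + 2 * - (frob a * u * v) * w"
      unfolding polar_def using beta a_eq by metis
    then show ?thesis
      by (simp add: algebra_simps)
  qed
  then have 1: "(u + v) * frob w = 2 * u * v * w"
    using assms a_nonzero by simp
  have "(frob u + frob v) * w = 2 * frob u * frob v * frob w"
    using arg_cong[OF 1, of frob] by simp
  \<comment> \<open>The factor u v clears the conjugates, since u and v have norm 1.\<close>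
  then have "u * v * ((frob u + frob v) * w) = u * v * (2 * frob u * frob v * frob w)"
    by simp
  moreover have "u * v * ((frob u + frob v) * w) = ((u * frob u) * v + (v * frob v) * u) * w"
    by (simp add: algebra_simps)
  moreover have "u * v * (2 * frob u * frob v * frob w) = 2 * (u * frob u) * (v * frob v) * frob w"
    by (simp add: algebra_simps)
  ultimately have 2: "(u + v) * w = 2 * frob w"
    by (simp add: norm_u norm_v add.commute)
  have "(u - v) ^ 2 * frob w = (u + v) * ((u + v) * frob w) - 2 * u * v * (2 * frob w)"
    by (simp add: algebra_simps power2_eq_square)
  also have "\<dots> = 0"
    unfolding 1 2[symmetric] by (simp add: algebra_simps)
  finally show ?thesis
    using u_neq_v by simp
qed

text \<open>Nondegeneracy lets every slope of a non-vertical hyperplane be written as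
  \<open>polar w\<close>.\<close>

lemma surj_polar: "surj polar"
proof (rule finite_UNIV_inj_surj)
  show "inj polar"
  proof (rule injI)
    fix x y assume "polar x = polar y"
    then have "polar (x - y) = 0"
      by (simp add: polar_def algebra_simps)
    then show "x = y"
      using polar_eq_0_imp by fastforce
  qed
qed simp

section \<open>Hyperplane sections of B(a,b), with n = r - 1\<close>

definition variety :: "nat \<Rightarrow> (nat \<Rightarrow> 'a) set" where
  "variety n = {x \<in> AG (Suc n). frob (x (Suc n)) - x (Suc n) = (\<Sum>i=1..n. form (x i))}"

text \<open>The sum lies in \<open>eigen (- 1)\<close>, so this is the twisted Hilbert 90 with u =
  1.\<close>

lemma card_variety_fibre:
  "card {z. frob z - z = (\<Sum>i=1..n. form (y i))} = q"
  using card_frob_fibre[of 1 "\<Sum>i=1..n. form (y i)"]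
  by (simp add: eigen_def frob_sum frob_form sum_negf)

lemma card_variety: "card (variety n) = q ^ (2 * n + 1)"
  unfolding variety_def
  by (subst card_AG_Suc_Collect)
    (simp add: card_variety_fibre card_AG card_UNIV power_add del: One_nat_def flip: power_mult)

definition vertical_hyperplane :: "nat \<Rightarrow> (nat \<Rightarrow> 'a) \<Rightarrow> 'a \<Rightarrow> (nat \<Rightarrow> 'a) set" where
  "vertical_hyperplane n c d = {x \<in> AG (Suc n). (\<Sum>i=1..n. c i * x i) = d}"

text \<open>Slopes are given through \<open>polar\<close> so that completing the square is
  translation by \<open>w\<close>.\<close>

definition graph_hyperplane :: "nat \<Rightarrow> (nat \<Rightarrow> 'a) \<Rightarrow> 'a \<Rightarrow> (nat \<Rightarrow> 'a) set" where
  "graph_hyperplane n w d = {x \<in> AG (Suc n). x (Suc n) = (\<Sum>i=1..n. polar (w i) * x i) + d}"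

lemma hyperplanes_Suc:
  "(hyperplanes (Suc n) :: (nat \<Rightarrow> 'a) set set) =
    {vertical_hyperplane n c d | c d. \<exists>i\<in>{1..n}. c i \<noteq> 0} \<union> {graph_hyperplane n w d | w d. True}"
  (is "?A = ?V \<union> ?G")
proof (intro equalityI subsetI)
  fix H :: "(nat \<Rightarrow> 'a) set" assume "H \<in> hyperplanes (Suc n)"
  then obtain c d where H: "H = {x \<in> AG (Suc n). (\<Sum>i=1..Suc n. c i * x i) = d}"
    and nz: "\<exists>i\<in>{1..Suc n}. c i \<noteq> 0"
    unfolding hyperplanes_def by blast
  show "H \<in> ?V \<union> ?G"
  proof (cases "c (Suc n) = 0")
    case True
    then have "\<exists>i\<in>{1..n}. c i \<noteq> 0"
      using nz by (metis atLeastAtMost_iff le_Suc_eq)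
    moreover have "H = vertical_hyperplane n c d"
      using True by (simp add: H vertical_hyperplane_def)
    ultimately show ?thesis
      by blast
  next
    case False
    have "\<exists>w. polar w = - c i / c (Suc n)" for i
      using surjD[OF surj_polar, of "- c i / c (Suc n)"] by metis
    then obtain w where w: "polar (w i) = - c i / c (Suc n)" for i
      by metis
    have "(\<Sum>i=1..n. polar (w i) * x i) = - (\<Sum>i=1..n. c i * x i) / c (Suc n)" for x
      by (simp add: w sum_divide_distrib sum_negf)
    then have "H = graph_hyperplane n w (d / c (Suc n))"
      using False by (auto simp: H graph_hyperplane_def field_simps)
    then show ?thesis
      by blast
  qed
next
  fix H :: "(nat \<Rightarrow> 'a) set" assume "H \<in> ?V \<union> ?G"
  then show "H \<in> hyperplanes (Suc n)"
  proof
    assume "H \<in> ?V"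
    then obtain c d where H: "H = vertical_hyperplane n c d" and c: "\<exists>i\<in>{1..n}. c i \<noteq> 0"
      by blast
    then obtain j where j: "j \<in> {1..n}" "c j \<noteq> 0"
      by blast
    \<comment> \<open>The value of \<open>c\<close> at \<open>Suc n\<close> is arbitrary and must be
      reset to 0.\<close>
    have "H = {x \<in> AG (Suc n). (\<Sum>i=1..Suc n. (c(Suc n := 0)) i * x i) = d}"
      by (simp add: H vertical_hyperplane_def)
    moreover have "\<exists>i\<in>{1..Suc n}. (c(Suc n := 0)) i \<noteq> 0"
      using j by (intro bexI[of _ j]) auto
    ultimately show ?thesis
      unfolding hyperplanes_def by blast
  next
    assume "H \<in> ?G"
    then obtain w d where H: "H = graph_hyperplane n w d"
      by blast
    let ?c = "\<lambda>i. if i = Suc n then 1 else - polar (w i)"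
    have "(\<Sum>i=1..n. ?c i * x i) = - (\<Sum>i=1..n. polar (w i) * x i)" for x
      by (simp add: sum_negf)
    then have "H = {x \<in> AG (Suc n). (\<Sum>i=1..Suc n. ?c i * x i) = d}"
      by (auto simp: H graph_hyperplane_def algebra_simps)
    moreover have "\<exists>i\<in>{1..Suc n}. ?c i \<noteq> 0"
      by (intro bexI[of _ "Suc n"]) auto
    ultimately show ?thesis
      unfolding hyperplanes_def by (intro CollectI exI[of _ ?c] exI[of _ d] conjI)
  qed
qed

text \<open>The last coordinate is unconstrained by the hyperplane, so each base point in it carries
  q points of the variety.\<close>

lemma card_vertical_hyperplane_variety:
  assumes "\<exists>i\<in>{1..n}. c i \<noteq> 0"
  shows "card (vertical_hyperplane n c d \<inter> variety n) = q ^ (2 * n - 1)"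
proof -
  let ?N = "card {y \<in> AG n. (\<Sum>i=1..n. c i * y i) = d}"
  have eq: "vertical_hyperplane n c d \<inter> variety n
      = {x \<in> AG (Suc n). (\<Sum>i=1..n. c i * x i) = d
          \<and> frob (x (Suc n)) - x (Suc n) = (\<Sum>i=1..n. form (x i))}"
    by (auto simp: vertical_hyperplane_def variety_def)
  have "card (vertical_hyperplane n c d \<inter> variety n)
      = (\<Sum>y\<in>AG n. card {z. (\<Sum>i=1..n. c i * y i) = d \<and> frob z - z = (\<Sum>i=1..n. form (y i))})"
    unfolding eq by (subst card_AG_Suc_Collect) simp
  also have "\<dots> = (\<Sum>y\<in>AG n. if (\<Sum>i=1..n. c i * y i) = d then q else 0)"
  proof (rule sum.cong[OF refl])
    show "card {z. (\<Sum>i=1..n. c i * y i) = d \<and> frob z - z = (\<Sum>i=1..n. form (y i))}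
      = (if (\<Sum>i=1..n. c i * y i) = d then q else 0)" for y
      using card_variety_fibre[where n = n and y = y] by (cases "(\<Sum>i=1..n. c i * y i) = d") simp_all
  qed
  also have "\<dots> = q * ?N"
    by (rule sum_if_const) simp
  finally have card: "card (vertical_hyperplane n c d \<inter> variety n) = q * ?N" .
  have "q ^ 2 * ?N = (q ^ 2) ^ n"
    using card_affine_hyperplane[OF assms, of d] by (simp only: card_UNIV)
  also have "\<dots> = q ^ (2 * n)"
    by (rule power_mult[symmetric])
  also have "\<dots> = q * q ^ (2 * n - 1)"
    using assms by (cases n) auto
  finally have "q * (q * ?N) = q * q ^ (2 * n - 1)"
    by (simp only: power2_eq_square mult.assoc)
  then show ?thesis
    using card q_gt_1 by simp
qed

text \<open>Completing the square in each coordinate removes the linear part, and only the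
  constant term of the resulting quadric matters.\<close>

lemma graph_hyperplane_equation:
  fixes y w :: "nat \<Rightarrow> 'a"
  assumes z: "z = (\<Sum>i=1..n. polar (w i) * y i) + d"
  shows "frob z - z = (\<Sum>i=1..n. form (y i))
    \<longleftrightarrow> (\<Sum>i=1..n. form (y i + w i)) = (\<Sum>i=1..n. form (w i)) + frob d - d"
proof -
  have "(\<Sum>i=1..n. form (y i + w i)) = (\<Sum>i=1..n. form (y i)) + (\<Sum>i=1..n. form (w i))
      + (\<Sum>i=1..n. polar (w i) * y i) - frob (\<Sum>i=1..n. polar (w i) * y i)"
    by (simp add: form_add sum.distrib sum_subtractf frob_sum)
  then have *: "frob z - z - (\<Sum>i=1..n. form (y i))
      = - ((\<Sum>i=1..n. form (y i + w i)) - ((\<Sum>i=1..n. form (w i)) + frob d - d))"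
    by (simp add: z)
  show ?thesis
    unfolding eq_iff_diff_eq_0[of "frob z - z"] eq_iff_diff_eq_0[of "\<Sum>i=1..n. form (y i + w i)"] *
    by (rule neg_equal_0_iff_equal)
qed

text \<open>The first n coordinates determine the point, and completing the square turns membership
  into one fibre of the translated sum of forms.\<close>

lemma card_graph_hyperplane_variety:
  assumes "n > 0" and e: "e = (\<Sum>i=1..n. form (w i)) + frob d - d"
  shows "card (graph_hyperplane n w d \<inter> variety n)
    = q ^ (2 * n - 1) - q ^ (n - 1) + (if e = 0 then q ^ n else 0)"
proof -
  let ?l = "\<lambda>y. (\<Sum>i=1..n. polar (w i) * y i) + d"
  let ?N = "card {y \<in> AG n. (\<Sum>i=1..n. form (y i + w i)) = e}"
  have eq: "graph_hyperplane n w d \<inter> variety n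
      = {x \<in> AG (Suc n). x (Suc n) = ?l x
          \<and> frob (x (Suc n)) - x (Suc n) = (\<Sum>i=1..n. form (x i))}"
    by (auto simp: graph_hyperplane_def variety_def)
  have "card (graph_hyperplane n w d \<inter> variety n)
      = (\<Sum>y\<in>AG n. card {z. z = ?l y \<and> frob z - z = (\<Sum>i=1..n. form (y i))})"
    unfolding eq by (subst card_AG_Suc_Collect) simp
  also have "\<dots> = (\<Sum>y\<in>AG n. if (\<Sum>i=1..n. form (y i + w i)) = e then 1 else 0)"
    by (simp only: card_Collect_eq_conj graph_hyperplane_equation[OF refl] e)
  also have "\<dots> = ?N"
    by (simp only: sum_if_const[OF finite_AG] mult_1)
  finally have card: "card (graph_hyperplane n w d \<inter> variety n) = ?N" .
  obtain k where k: "n = Suc k"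
    using assms(1) by (cases n) auto
  have "frob e = - e"
    by (simp add: e frob_sum frob_form sum_negf)
  from card_sum_form_translate_eq[OF this, of n w]
  have "q * (?N + q ^ k) = q * (q ^ (2 * k + 1) + (if e = 0 then q ^ n else 0))"
    by (simp add: k algebra_simps del: sum.cl_ivl_Suc)
  then have "?N + q ^ k = q ^ (2 * k + 1) + (if e = 0 then q ^ n else 0)"
    by (rule nat_mult_eq_cancel1[THEN iffD1, rotated]) (use q_gt_1 in simp)
  moreover have "q ^ k \<le> q ^ (2 * k + 1)"
    using q_gt_1 by (intro power_increasing) auto
  ultimately have "?N = q ^ (2 * k + 1) - q ^ k + (if e = 0 then q ^ n else 0)"
    by linarith
  moreover have "2 * n - 1 = 2 * k + 1" "n - 1 = k"
    using k by auto
  ultimately show ?thesis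
    by (simp only: card)
qed

lemma card_hyperplane_variety_image:
  assumes "n > 0"
  shows "(\<lambda>H. card (H \<inter> variety n)) ` hyperplanes (Suc n)
    = {q ^ (2 * n - 1) - q ^ (n - 1), q ^ (2 * n - 1), q ^ (2 * n - 1) - q ^ (n - 1) + q ^ n}"
    (is "?f ` _ = {?s, ?m, ?l}")
proof
  show "?f ` hyperplanes (Suc n) \<subseteq> {?s, ?m, ?l}"
    unfolding hyperplanes_Suc
    using card_vertical_hyperplane_variety card_graph_hyperplane_variety[OF assms refl] by auto
next
  \<comment> \<open>Witnesses for the three sizes: x_r = d with d outside GF(q), x_r = 0, and the
    vertical hyperplane with coordinate sum 0.\<close>
  obtain d where d: "frob d \<noteq> d"
    using exists_frob_neq by blast
  have graph: "graph_hyperplane n w d' \<in> hyperplanes (Suc n)" for w d'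
    unfolding hyperplanes_Suc by blast
  have c: "\<exists>i\<in>{1..n}. (\<lambda>_. 1 :: 'a) i \<noteq> 0"
    using assms by (intro bexI[of _ 1]) auto
  then have vertical: "vertical_hyperplane n (\<lambda>_. 1) 0 \<in> hyperplanes (Suc n)"
    unfolding hyperplanes_Suc by blast
  have "?f (graph_hyperplane n (\<lambda>_. 0) d) = ?s"
    using d card_graph_hyperplane_variety[OF assms refl, of "\<lambda>_. 0" d] by simp
  then have "?s \<in> ?f ` hyperplanes (Suc n)"
    using graph by (rule image_eqI[OF sym])
  moreover have "?f (graph_hyperplane n (\<lambda>_. 0) 0) = ?l"
    using card_graph_hyperplane_variety[OF assms refl, of "\<lambda>_. 0" 0] by simp
  then have "?l \<in> ?f ` hyperplanes (Suc n)"
    using graph by (rule image_eqI[OF sym])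
  moreover have "?f (vertical_hyperplane n (\<lambda>_. 1) 0) = ?m"
    using c by (rule card_vertical_hyperplane_variety)
  then have "?m \<in> ?f ` hyperplanes (Suc n)"
    using vertical by (rule image_eqI[OF sym])
  ultimately show "{?s, ?m, ?l} \<subseteq> ?f ` hyperplanes (Suc n)"
    by (simp only: insert_subset empty_subsetI simp_thms)
qed

lemma exists_small_hyperplane:
  assumes "n > 0" and P: "P \<in> variety n"
  obtains H where "H \<in> hyperplanes (Suc n)" "P \<in> H"
    "card (H \<inter> variety n) = q ^ (2 * n - 1) - q ^ (n - 1)"
proof -
  obtain t where t: "form t \<noteq> 0"
    using exists_form_neq_0 by blast
  \<comment> \<open>This choice makes P + w equal to (t, 0, ..., 0) on the first n coordinates, so
    the translated sum is \<open>form t\<close>; \<open>d\<close> then places P on the hyperplane.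
    As P lies on the variety, the constant deciding the section size equals \<open>form t\<close>,
    which is nonzero.\<close>
  define w where "w i = (if i = 1 then t else 0) - P i" for i
  define d where "d = P (Suc n) - (\<Sum>i=1..n. polar (w i) * P i)"
  have "(\<Sum>i=1..n. form (P i + w i)) = (\<Sum>i=1..n. if i = 1 then form t else 0)"
    by (intro sum.cong) (auto simp: w_def)
  also have "\<dots> = form t"
    using assms(1) by simp
  finally have "(\<Sum>i=1..n. form (w i)) + frob d - d \<noteq> 0"
    using graph_hyperplane_equation[OF refl, of w P n d] P t by (simp add: d_def variety_def)
  then have "card (graph_hyperplane n w d \<inter> variety n) = q ^ (2 * n - 1) - q ^ (n - 1)"
    using card_graph_hyperplane_variety[OF assms(1) refl] by simp
  moreover have "P \<in> graph_hyperplane n w d"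
    using P by (simp add: graph_hyperplane_def variety_def d_def)
  moreover have "graph_hyperplane n w d \<in> hyperplanes (Suc n)"
    unfolding hyperplanes_Suc by blast
  ultimately show thesis
    using that by blast
qed

lemma character_set_variety:
  assumes "n > 0"
  shows "character_set (Suc n) 3
    {q ^ (2 * n - 1) - q ^ (n - 1), q ^ (2 * n - 1), q ^ (2 * n - 1) - q ^ (n - 1) + q ^ n}
    (variety n)"
proof -
  have "q ^ (n - 1) < q ^ n" "q ^ (n - 1) \<le> q ^ (2 * n - 1)" "0 < q ^ (n - 1)"
    using q_gt_1 assms by (auto intro!: power_increasing)
  moreover have "card {x - y, x, x - y + z} = 3" if "y < z" "y \<le> x" "0 < y" for x y z :: nat
    using that by (auto simp: card_insert_if)
  ultimately have "card {q ^ (2 * n - 1) - q ^ (n - 1), q ^ (2 * n - 1),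
      q ^ (2 * n - 1) - q ^ (n - 1) + q ^ n} = 3"
    by blast
  then show ?thesis
    using card_hyperplane_variety_image[OF assms]
    by (auto simp: character_set_def variety_def)
qed

lemma minimal_intersection_set_variety:
  assumes "n > 0"
  shows "minimal_intersection_set (Suc n) (q ^ (2 * n - 1) - q ^ (n - 1)) (variety n)"
proof -
  let ?t = "q ^ (2 * n - 1) - q ^ (n - 1)"
  have "q ^ (n - 1) < q ^ (2 * n - 1)"
    using q_gt_1 assms by (intro power_strict_increasing) auto
  moreover have "?t \<le> card (H \<inter> variety n)" if "H \<in> hyperplanes (Suc n)" for H
  proof -
    have "card (H \<inter> variety n) \<in> {?t, q ^ (2 * n - 1), ?t + q ^ n}"
      using that card_hyperplane_variety_image[OF assms] by blast
    then show ?thesis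
      by auto
  qed
  ultimately have "intersection_set (Suc n) ?t (variety n)"
    by (auto simp: intersection_set_def variety_def)
  moreover have "essential_point (Suc n) ?t (variety n) P" if P: "P \<in> variety n" for P
  proof -
    obtain H where H: "H \<in> hyperplanes (Suc n)" "P \<in> H" "card (H \<inter> variety n) = ?t"
      using exists_small_hyperplane[OF assms P] .
    have "finite (H \<inter> variety n)"
      by (simp add: variety_def)
    then have "card (H \<inter> (variety n - {P})) < card (H \<inter> variety n)"
      by (rule psubset_card_mono) (use H(2) P in auto)
    then show ?thesis
      using P H by (auto simp: essential_point_def intersection_set_def not_le)
  qed
  ultimately show ?thesis
    by (simp add: minimal_intersection_set_def)
qed

end

section \<open>Hyperbolicity from the hypotheses on a and b\<close>

context conjugation
begin

text \<open>\<open>u\<close> and \<open>v\<close> come from the quadratic formula for a^q X^2 -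
  \<beta> X - a, with discriminant s^2. Conjugation fixes s and negates \<beta>, so each norm is (s
  + \<beta>)(s - \<beta>) / (4 a^(q+1)) = 1.\<close>

lemma hyperbolic_form_odd:
  assumes "odd q" and a: "a \<noteq> 0" and \<beta>: "frob \<beta> = - \<beta>"
    and s: "frob s = s" "s \<noteq> 0" "4 * (a * frob a) + \<beta> ^ 2 = s ^ 2"
  shows "\<exists>u v. hyperbolic_form q frob a \<beta> u v"
proof -
  have two: "(2 :: 'a) \<noteq> 0"
    using assms(1) even_q_iff by simp
  define u where "u = (\<beta> + s) / (2 * frob a)"
  define v where "v = (\<beta> - s) / (2 * frob a)"
  have 4: "(s + \<beta>) * (s - \<beta>) = 4 * (a * frob a)"
    using s(3) by (simp add: algebra_simps power2_eq_square)
  have "(4 :: 'a) = 2 * 2"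
    by simp
  then have four: "(4 :: 'a) \<noteq> 0"
    using two by (metis mult_eq_0_iff)
  have "u * frob u = ((s + \<beta>) * (s - \<beta>)) / (4 * (a * frob a))"
    by (simp add: u_def s \<beta> algebra_simps)
  also have "\<dots> = 1"
    unfolding 4 using a four by simp
  finally have "u * frob u = 1" .
  moreover have "v * frob v = ((s + \<beta>) * (s - \<beta>)) / (4 * (a * frob a))"
    by (simp add: v_def s \<beta> algebra_simps)
  then have "v * frob v = 1"
    unfolding 4 using a four by simp
  moreover have "u - v = (2 * s) / (2 * frob a)"
    by (simp add: u_def v_def flip: diff_divide_distrib)
  then have "u \<noteq> v"
    using s(2) a two by auto
  moreover have "u + v = (2 * \<beta>) / (2 * frob a)"
    by (simp add: u_def v_def flip: add_divide_distrib)
  then have "\<beta> = frob a * (u + v)"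
    using two a by simp
  moreover have "u * v = - ((s + \<beta>) * (s - \<beta>)) / (4 * (frob a * frob a))"
    by (simp add: u_def v_def algebra_simps)
  then have "u * v = - (a / frob a)"
    unfolding 4 using a four by (simp add: field_simps)
  then have "a = - (frob a * u * v)"
    using a by (simp add: mult.assoc)
  ultimately have "hyperbolic_form q frob a \<beta> u v"
    by unfold_locales (use a in auto)
  then show ?thesis
    by blast
qed

text \<open>Substituting X = \<beta> w / a^q turns the quadratic into w^2 + w = a^(q+1) / \<beta>^2.
  The trace condition makes its two roots w and w + 1 conjugate, which gives norm 1.\<close>

lemma hyperbolic_form_even:
  assumes "even q" "q = 2 ^ h" and a: "a \<noteq> 0" and \<beta>: "frob \<beta> = \<beta>" "\<beta> \<noteq> 0"
    and tr: "abs_trace h (a * frob a / \<beta> ^ 2) = 1"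
  shows "\<exists>u v. hyperbolic_form q frob a \<beta> u v"
proof -
  have two: "(2 :: 'a) = 0"
    using assms(1) even_q_iff by simp
  have minus: "- x = x" for x :: 'a
    using assms(1) by (rule uminus_eq_if_even)
  have "frob (a * frob a / \<beta> ^ 2) = a * frob a / \<beta> ^ 2"
    using \<beta> by simp
  from char_2_artin_schreier[OF assms(1,2) this tr]
  obtain w where w: "w ^ 2 + w = a * frob a / \<beta> ^ 2" and fw: "frob w = w + 1" .
  define u where "u = \<beta> * w / frob a"
  define v where "v = \<beta> * (w + 1) / frob a"
  have w': "\<beta> ^ 2 * (w * (w + 1)) = a * frob a"
    using w \<beta>(2) by (simp add: field_simps power2_eq_square)
  have frob_w1: "frob (w + 1) = w"
    using two by (simp add: fw)
  have "u * frob u = \<beta> ^ 2 * (w * (w + 1)) / (a * frob a)"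
    by (simp add: u_def \<beta> fw power2_eq_square algebra_simps)
  then have "u * frob u = 1"
    unfolding w' using a by simp
  moreover have "v * frob v = \<beta> ^ 2 * (w * (w + 1)) / (a * frob a)"
    unfolding v_def frob_divide frob_mult frob_w1 by (simp add: \<beta> power2_eq_square algebra_simps)
  then have "v * frob v = 1"
    unfolding w' using a by simp
  moreover have "v - u = \<beta> / frob a"
    using a by (simp add: u_def v_def field_simps)
  then have "u \<noteq> v"
    using \<beta>(2) a by auto
  moreover have "frob a * (u + v) = \<beta> * (2 * w + 1)"
    using a by (simp add: u_def v_def field_simps)
  then have "\<beta> = frob a * (u + v)"
    using two by simp
  moreover have "u * v = \<beta> ^ 2 * (w * (w + 1)) / (frob a * frob a)"
    by (simp add: u_def v_def power2_eq_square algebra_simps)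
  then have "u * v = a / frob a"
    unfolding w' using a by simp
  then have "a = - (frob a * u * v)"
    using a by (simp only: minus) (simp add: mult.assoc)
  ultimately have "hyperbolic_form q frob a \<beta> u v"
    by unfold_locales (use a in auto)
  then show ?thesis
    by blast
qed

end

theorem theorem3p2:
  fixes q r :: nat
    and GFq :: "'a::{field,finite} set"
    and a b :: 'a
  assumes "primepow q"
    and "card (UNIV :: 'a set) = q ^ 2"
    and "is_subfield GFq" and "card GFq = q"
    and "r \<ge> 2" and "even r"
    and "a \<noteq> 0" and "b \<notin> GFq"
    and "(odd q \<and> (\<exists>s\<in>GFq. s \<noteq> 0 \<and> 4 * a ^ (q + 1) + (b ^ q - b) ^ 2 = s ^ 2)) \<or>
         (even q \<and> (\<exists>h. q = 2 ^ h \<and> abs_trace h (a ^ (q + 1) / (b ^ q + b) ^ 2) = 1))"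
  shows "card (B_set q r a b) = q ^ (2 * r - 1)
    \<and> character_set r 3
         {q ^ (2 * r - 3) - q ^ (r - 2),
          q ^ (2 * r - 3),
          q ^ (2 * r - 3) - q ^ (r - 2) + q ^ (r - 1)}
         (B_set q r a b)
    \<and> minimal_intersection_set r (q ^ (2 * r - 3) - q ^ (r - 2)) (B_set q r a b)"
proof -
  define frob where "frob x = x ^ q" for x :: 'a
  interpret conjugation q frob
    using assms(1,2) by unfold_locales (auto simp: frob_def)
  define \<beta> where "\<beta> = frob b - b"
  have GFq: "GFq = eigen 1"
    using assms(3,4) by (rule subfield_eq_eigen_1)
  have "\<exists>u v. hyperbolic_form q frob a \<beta> u v"
  proof (cases "even q")
    case False
    then obtain s where "frob s = s" "s \<noteq> 0" "4 * (a * frob a) + \<beta> ^ 2 = s ^ 2"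
      using assms(9) by (auto simp: GFq eigen_def frob_def \<beta>_def)
    then show ?thesis
      using False assms(7) by (intro hyperbolic_form_odd) (auto simp: \<beta>_def)
  next
    case True
    then have minus: "- x = x" for x :: 'a
      by (rule uminus_eq_if_even)
    \<comment> \<open>In characteristic 2 the denominator of the trace condition is
      \<beta>^2.\<close>
    then have \<beta>': "\<beta> = b ^ q + b"
      by (metis \<beta>_def diff_conv_add_uminus frob_def)
    obtain h where "q = 2 ^ h" "abs_trace h (a * frob a / \<beta> ^ 2) = 1"
      using assms(9) True by (auto simp: \<beta>' frob_def)
    moreover have "\<beta> \<noteq> 0"
      using assms(8) by (auto simp: \<beta>_def GFq eigen_def)
    moreover have "frob \<beta> = \<beta>"
      using minus[of \<beta>] by (simp add: \<beta>_def)
    ultimately show ?thesis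
      using True assms(7) by (intro hyperbolic_form_even) auto
  qed
  then obtain u v where "hyperbolic_form q frob a \<beta> u v"
    by blast
  then interpret hyperbolic_form q frob a \<beta> u v .
  obtain n where n: "r = Suc n" "n > 0"
    using assms(5) by (cases r) auto
  \<comment> \<open>Moving the terms with a to the right collects the equation into a sum of values
    of \<open>form\<close>.\<close>
  have "(x (Suc n) ^ q - x (Suc n) + a ^ q * (\<Sum>i=1..n. x i ^ (2 * q)) - a * (\<Sum>i=1..n. x i ^ 2)
        = (b ^ q - b) * (\<Sum>i=1..n. x i ^ (q + 1)))
      \<longleftrightarrow> frob (x (Suc n)) - x (Suc n) = (\<Sum>i=1..n. form (x i))" for x :: "nat \<Rightarrow> 'a"
  proof -
    have "x i ^ (2 * q) = frob (x i) ^ 2" for i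
      by (simp add: frob_def mult.commute flip: power_mult)
    then have *: "(\<Sum>i=1..n. form (x i)) = (frob b - b) * (\<Sum>i=1..n. x i ^ (q + 1))
        - frob a * (\<Sum>i=1..n. x i ^ (2 * q)) + a * (\<Sum>i=1..n. x i ^ 2)"
      unfolding form_def
      by (simp add: sum.distrib sum_subtractf sum_distrib_left \<beta>_def frob_def)
    have "(p + \<alpha> - \<gamma> = \<delta>) \<longleftrightarrow> p = \<delta> - \<alpha> + \<gamma>" for p \<alpha> \<gamma> \<delta> :: 'a
      by (auto simp: algebra_simps)
    then show ?thesis
      unfolding * frob_def .
  qed
  then have B: "B_set q r a b = variety n"
    by (simp add: B_set_def variety_def n)
  have exponents: "2 * r - 1 = 2 * n + 1" "2 * r - 3 = 2 * n - 1" "r - 2 = n - 1" "r - 1 = n"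
    using n by auto
  show ?thesis
    unfolding B exponents using n card_variety character_set_variety minimal_intersection_set_variety
    by simp
qed

end
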